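(* Let $V=(v_{ij})\in(\mathbb R\cup\{\infty\})^{d\times n}$ and let $\Psi$ be a subgraph of the complete bipartite graph $[d]\times[n]$. If $V$ is tropically generic with respect to the tropical semiring $\mathbb T_{\min}$, then the max-tropical cone $\operatorname{thalf}(V,\Psi)$ is pure and full-dimensional.
   Context: $\mathbb T_{\min}=(\mathbb R\cup\{\infty\},\min,+)$. Subgraphs of the complete bipartite graph $[d]\times[n]$ are identified with sets of arcs $(i,j)$, $i\in[d]$, $j\in[n]$. $v^{(j)}$ denotes the $j$th column of $V$, assumed not identically $\infty$. For $u\in\mathbb T_{\min}^d$ and $i$ with $u_i\neq\infty$ the sector is $S_i(u)=\{z\in\mathbb R^d : z_\ell-z_i\le u_\ell-u_i \text{ for all }\ell\in[d]\text{ with }u_\ell\ne\infty\}$ (for $u_i=\infty$ put $S_i(u)=\emptyset$). Define $$\operatorname{thalf}(V,\Psi)=\bigcap_{j\in[n]}\ \bigcup_{i:(i,j)\in\Psi}S_i(v^{(j)})\subseteq\mathbb R^d .$$ The sectors $S_i(u)$ with $u_i\neq\infty$ are the maximal cells of a polyhedral complex $\Delta(u)$ covering $\mathbb R^d$ (its cells are intersections of nonempty families of these sectors). The covector decomposition $\mathcal T(V)$ of $\mathbb R^d$ is the common refinement of $\Delta(v^{(1)}),\dots,\Delta(v^{(n)})$. The set $\operatorname{thalf}(V,\Psi)$ is a union of cells of $\mathcal T(V)$, and its covector decomposition consists of the cells of $\mathcal T(V)$ contained in it. The cone is pure if all inclusion-maximal cells of its covector decomposition have the same dimension; it is pure and full-dimensional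 if all these inclusion-maximal cells have dimension $d$ (a vacuous condition if $\operatorname{thalf}(V,\Psi)=\emptyset$). The tropical determinant of a square matrix $W=(w_{ij})\in\mathbb T_{\min}^{k\times k}$ is $\operatorname{tdet}W=\min_{\sigma\in\operatorname{Sym}(k)}(w_{1,\sigma(1)}+\dots+w_{k,\sigma(k)})$. It vanishes if this minimum equals $\infty$ or is attained at least twice (by at least two permutations). A matrix is tropically generic if the tropical determinant of no square submatrix vanishes. *)

theory Defs
  imports "HOL-Analysis.Analysis"
begin

text \<open>
  The tropical semiring (R with infinity, min, +) is represented inside \<^typ>\<open>ereal\<close>; the value
  \<open>-\<infinity>\<close> has to be excluded by a hypothesis wherever it matters.
\<close>

definition tropical_matrix :: "ereal^'n^'d \<Rightarrow> bool" where
  "tropical_matrix V \<longleftrightarrow> (\<forall>i j. V $ i $ j \<noteq> -\<infinity>)"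


subsection \<open>Tropical determinants and genericity\<close>

text \<open>Square matrices of varying size \<open>k\<close> are functions on indices below \<open>k\<close>.\<close>

definition perm_weight :: "nat \<Rightarrow> (nat \<Rightarrow> nat \<Rightarrow> ereal) \<Rightarrow> (nat \<Rightarrow> nat) \<Rightarrow> ereal" where
  "perm_weight k W \<sigma> = (\<Sum>a<k. W a (\<sigma> a))"

definition tdet :: "nat \<Rightarrow> (nat \<Rightarrow> nat \<Rightarrow> ereal) \<Rightarrow> ereal" where
  "tdet k W = Min (perm_weight k W ` {\<sigma>. \<sigma> permutes {..<k}})"

definition tdet_vanishes :: "nat \<Rightarrow> (nat \<Rightarrow> nat \<Rightarrow> ereal) \<Rightarrow> bool" where
  "tdet_vanishes k W \<longleftrightarrow>
     tdet k W = \<infinity> \<or>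
     (\<exists>\<sigma> \<tau>. \<sigma> permutes {..<k} \<and> \<tau> permutes {..<k} \<and> \<sigma> \<noteq> \<tau> \<and>
            perm_weight k W \<sigma> = tdet k W \<and> perm_weight k W \<tau> = tdet k W)"

text \<open>
  A square submatrix is given by injective enumerations of its rows and of its columns. The index
  types carry no order, so every ordering of the selected rows and columns is allowed; the
  condition does not depend on it. The case \<open>k = 0\<close> holds trivially.
\<close>

definition tropically_generic :: "ereal^'n^'d \<Rightarrow> bool" where
  "tropically_generic V \<longleftrightarrow>
     (\<forall>k (r :: nat \<Rightarrow> 'd) (c :: nat \<Rightarrow> 'n).
        inj_on r {..<k} \<and> inj_on c {..<k} \<longrightarrow> \<not> tdet_vanishes k (\<lambda>a b. V $ r a $ c b))"


subsection \<open>Sectors, the cone, and its covector decomposition\<close>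

definition sector :: "ereal^'d \<Rightarrow> 'd \<Rightarrow> (real^'d) set" where
  "sector u i =
     (if u $ i = \<infinity> then {}
      else {z. \<forall>l. u $ l \<noteq> \<infinity> \<longrightarrow> ereal (z $ l - z $ i) \<le> u $ l - u $ i})"

definition thalf :: "ereal^'n^'d \<Rightarrow> ('d \<times> 'n) set \<Rightarrow> (real^'d) set" where
  "thalf V \<Psi> = (\<Inter>j. \<Union>i\<in>{i. (i, j) \<in> \<Psi>}. sector (column j V) i)"

definition sector_complex :: "ereal^'d \<Rightarrow> (real^'d) set set" where
  "sector_complex u = {\<Inter>i\<in>I. sector u i | I. I \<noteq> {} \<and> I \<subseteq> {i. u $ i \<noteq> \<infinity>}}"

text \<open>
  The common refinement of the complexes of the columns. The empty set is not counted as a cell: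
  otherwise it would be an inclusion-maximal cell of an empty cone.
\<close>

definition covector_decomposition :: "ereal^'n^'d \<Rightarrow> (real^'d) set set" where
  "covector_decomposition V =
     {\<Inter>j. C j | C. \<forall>j. C j \<in> sector_complex (column j V)} - {{}}"

definition thalf_decomposition :: "ereal^'n^'d \<Rightarrow> ('d \<times> 'n) set \<Rightarrow> (real^'d) set set" where
  "thalf_decomposition V \<Psi> = {C \<in> covector_decomposition V. C \<subseteq> thalf V \<Psi>}"

definition maximal_cells :: "'a set set \<Rightarrow> 'a set set" where
  "maximal_cells K = {C \<in> K. \<forall>D\<in>K. C \<subseteq> D \<longrightarrow> D = C}"

definition pure_full_dimensional :: "'a::euclidean_space set set \<Rightarrow> bool" where
  "pure_full_dimensional K \<longleftrightarrow> (\<forall>C\<in>maximal_cells K. aff_dim C = int DIM('a))"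

end

theory Submission
  imports Defs
begin

text \<open>
  Applied to \<open>1 \<times> 1\<close> minors, genericity makes all entries finite, so \<open>z\<close> lies in the sector
  \<open>S\<^sub>i(v\<^sup>(\<^sup>j\<^sup>))\<close> iff \<open>i\<close> maximizes \<open>z\<^sub>i - v\<^sub>i\<^sub>j\<close>. Let \<open>z\<close> be a point of a maximal cell \<open>C\<close> lying in as few
  sectors as possible, and choose for every column \<open>j\<close> a maximizer \<open>s j\<close> at \<open>z\<close> with
  \<open>(s j, j) \<in> \<Psi>\<close>. The relation \<open>i \<rightarrow> s j\<close>, for maximizers \<open>i \<noteq> s j\<close> of column \<open>j\<close> at \<open>z\<close>, has no cycle:
  a cycle would give two distinct optimal permutations of a submatrix. Hence some \<open>w\<close> increases
  strictly along this relation, and for small \<open>e > 0\<close> the point \<open>z + e w\<close> is interior to the cell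
  \<open>\<Inter>j. S\<^bsub>s j\<^esub>(v\<^sup>(\<^sup>j\<^sup>))\<close>. This cell is contained in the cone, and it contains \<open>C\<close> by the choice of \<open>z\<close>.
\<close>

text \<open>For acyclic \<open>R\<close>, counting the predecessors under \<open>R\<^sup>+\<close>
  gives a rank. Otherwise a successor function on the points lying on cycles permutes some nonempty
  set. This replaces an explicit cycle, since a permutation is what a determinant can use.\<close>

lemma strict_rank_or_permuted_subset:
  fixes R :: "('a::finite \<times> 'a) set"
  obtains (rank) w :: "'a \<Rightarrow> nat" where "\<And>x y. (x, y) \<in> R \<Longrightarrow> w x < w y"
  | (cycle) A f where "A \<noteq> {}" "bij_betw f A A" "\<And>x. x \<in> A \<Longrightarrow> (x, f x) \<in> R"
proof (cases "acyclic R")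
  case True
  define w where "w x = card {y. (y, x) \<in> R\<^sup>+}" for x
  have "w x < w y" if "(x, y) \<in> R" for x y
    unfolding w_def
  proof (rule psubset_card_mono)
    show "{z. (z, x) \<in> R\<^sup>+} \<subset> {z. (z, y) \<in> R\<^sup>+}"
      using that True by (auto simp: acyclic_def intro: trancl_into_trancl)
  qed simp
  then show ?thesis by (rule rank)
next
  case False
  define M where "M = {x. (x, x) \<in> R\<^sup>+}"
  have "\<exists>y\<in>M. (x, y) \<in> R" if "x \<in> M" for x
    using that by (auto simp: M_def dest!: tranclD intro: rtrancl_into_trancl1)
  then obtain f where f: "\<And>x. x \<in> M \<Longrightarrow> f x \<in> M \<and> (x, f x) \<in> R"
    by metis
  define P where "P A \<longleftrightarrow> A \<noteq> {} \<and> A \<subseteq> M \<and> f ` A \<subseteq> A" for A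
  have "P M"
    using False f unfolding P_def M_def acyclic_def by auto
  then obtain A where A: "P A" and min: "\<And>B. P B \<Longrightarrow> card A \<le> card B"
    using ex_has_least_nat[of P M card] by blast
  have "P (f ` A)"
    using A by (auto simp: P_def)
  then have "f ` A = A"
    using A min by (simp add: P_def card_seteq)
  then have "bij_betw f A A"
    by (simp add: bij_betw_def eq_card_imp_inj_on)
  moreover have "A \<noteq> {}" "\<And>x. x \<in> A \<Longrightarrow> (x, f x) \<in> R"
    using A f by (auto simp: P_def)
  ultimately show ?thesis by (intro cycle)
qed

section \<open>Genericity and tropical determinants\<close>

lemma generic_entry_finite:
  assumes "tropically_generic V"
  shows "V $ i $ j \<noteq> \<infinity>"
proof
  assume inf: "V $ i $ j = \<infinity>"
  have "{\<sigma>. \<sigma> permutes {..<1::nat}} = {id}"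
    by (auto simp: lessThan_Suc)
  then have "tdet 1 (\<lambda>a b. V $ i $ j) = \<infinity>"
    by (simp add: tdet_def perm_weight_def inf)
  then have "tdet_vanishes 1 (\<lambda>a b. V $ i $ j)"
    by (simp add: tdet_vanishes_def)
  moreover have "inj_on (\<lambda>_. i) {..<1::nat}" "inj_on (\<lambda>_. j) {..<1::nat}"
    by (auto simp: inj_on_def)
  ultimately show False
    using assms[unfolded tropically_generic_def, rule_format, of "\<lambda>_. i" 1 "\<lambda>_. j"] by blast
qed

text \<open>Complementary slackness for the assignment problem: \<open>x\<close> and \<open>m\<close> form a dual feasible solution.\<close>

lemma tdet_vanishes_if_tight_permutations:
  fixes v :: "nat \<Rightarrow> nat \<Rightarrow> real" and x m :: "nat \<Rightarrow> real"
  assumes feasible: "\<And>a b. x a - m b \<le> v a b"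
    and \<sigma>: "\<sigma> permutes {..<k}" "\<And>a. a < k \<Longrightarrow> v a (\<sigma> a) = x a - m (\<sigma> a)"
    and \<tau>: "\<tau> permutes {..<k}" "\<And>a. a < k \<Longrightarrow> v a (\<tau> a) = x a - m (\<tau> a)"
    and "\<sigma> \<noteq> \<tau>"
  shows "tdet_vanishes k (\<lambda>a b. ereal (v a b))"
proof -
  let ?W = "\<lambda>a b. ereal (v a b)"
  define D where "D = (\<Sum>a<k. x a) - (\<Sum>a<k. m a)"
  have weight: "perm_weight k ?W \<rho> = ereal (\<Sum>a<k. v a (\<rho> a))" for \<rho>
    by (simp add: perm_weight_def)
  \<comment> \<open>A permutation only reorders the sum of \<open>m\<close>; hence \<open>D\<close>
    bounds all weights from below, and tight permutations attain it.\<close>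
  have dual: "(\<Sum>a<k. x a - m (\<rho> a)) = D" if "\<rho> permutes {..<k}" for \<rho>
    using sum.permute[OF that, of m] by (simp add: D_def sum_subtractf o_def)
  have lower: "ereal D \<le> perm_weight k ?W \<rho>" if "\<rho> permutes {..<k}" for \<rho>
    unfolding weight dual[OF that, symmetric] by (simp add: sum_mono feasible)
  have eq: "perm_weight k ?W \<sigma> = ereal D" "perm_weight k ?W \<tau> = ereal D"
    unfolding weight using \<sigma> \<tau> dual by auto
  have "tdet k ?W = ereal D"
    unfolding tdet_def using lower eq \<sigma>(1)
    by (intro Min_eqI) (auto simp: finite_permutations intro!: image_eqI[where x = \<sigma>])
  then show ?thesis
    using eq \<sigma>(1) \<tau>(1) \<open>\<sigma> \<noteq> \<tau>\<close> by (auto simp: tdet_vanishes_def)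
qed

lemma generic_no_tight_cycle:
  fixes V :: "ereal^'n^'d" and v :: "'d \<Rightarrow> 'n \<Rightarrow> real"
  assumes generic: "tropically_generic V"
    and v: "\<And>i j. V $ i $ j = ereal (v i j)"
    and feasible: "\<And>i j. x i - m j \<le> v i j"
    and A: "A \<noteq> {}" and f: "bij_betw f A A" and g: "inj_on g A"
    and ne: "\<And>i. i \<in> A \<Longrightarrow> f i \<noteq> i"
    and tight: "\<And>i. i \<in> A \<Longrightarrow> v i (g i) = x i - m (g i)"
    and tight_f: "\<And>i. i \<in> A \<Longrightarrow> v (f i) (g i) = x (f i) - m (g i)"
  shows False
proof -
  define k where "k = card A"
  obtain r where r: "bij_betw r {..<k} A"
    using ex_bij_betw_nat_finite[of A] by (auto simp: k_def lessThan_atLeast0)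
  have rA: "r a \<in> A" if "a < k" for a
    using r that by (auto simp: bij_betw_def)
  \<comment> \<open>With columns enumerated by \<open>g (r b)\<close>, the identity encodes the
    first matching. The second pairs row \<open>r a\<close> with the column of its
    \<open>f\<close>-preimage, so it is the inverse of \<open>f\<close> transported along
    \<open>r\<close>.\<close>
  define \<pi> where "\<pi> = inv_into {..<k} r \<circ> inv_into A f \<circ> r"
  define \<sigma> where "\<sigma> a = (if a < k then \<pi> a else a)" for a
  have "bij_betw \<pi> {..<k} {..<k}"
    unfolding \<pi>_def
    by (rule bij_betw_trans[OF r bij_betw_trans[OF bij_betw_inv_into[OF f] bij_betw_inv_into[OF r]]])
  then have "bij_betw \<sigma> {..<k} {..<k}"
    by (subst bij_betw_cong[where g = \<pi>]) (auto simp: \<sigma>_def)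
  then have \<sigma>: "\<sigma> permutes {..<k}"
    by (rule bij_imp_permutes) (simp add: \<sigma>_def)
  have f\<sigma>: "f (r (\<sigma> a)) = r a" "\<sigma> a < k" if "a < k" for a
  proof -
    have ia: "inv_into A f (r a) \<in> A"
      using f rA[OF that] by (metis bij_betw_def inv_into_into)
    have "r (\<sigma> a) = inv_into A f (r a)"
      using that r ia by (simp add: \<sigma>_def \<pi>_def bij_betw_inv_into_right)
    then show "f (r (\<sigma> a)) = r a"
      using f rA[OF that] by (simp add: bij_betw_inv_into_right)
    show "\<sigma> a < k"
      using permutes_in_image[OF \<sigma>, of a] that by simp
  qed
  have "k > 0"
    using A by (simp add: k_def card_gt_0_iff)
  then have "\<sigma> \<noteq> id"
    using f\<sigma>[of 0] ne[OF rA, of 0] by auto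
  moreover have "v (r a) (g (r (\<sigma> a))) = x (r a) - m (g (r (\<sigma> a)))" if "a < k" for a
    using tight_f[OF rA[OF f\<sigma>(2)[OF that]]] f\<sigma>(1)[OF that] by simp
  ultimately have "tdet_vanishes k (\<lambda>a b. ereal (v (r a) (g (r b))))"
    using \<sigma> rA feasible tight
    by (intro tdet_vanishes_if_tight_permutations[where x = "\<lambda>a. x (r a)"
          and m = "\<lambda>b. m (g (r b))" and \<sigma> = \<sigma> and \<tau> = id])
      auto
  moreover have "inj_on r {..<k}" "inj_on (\<lambda>a. g (r a)) {..<k}"
    using r g comp_inj_on[of r "{..<k}" g] by (auto simp: bij_betw_def o_def)
  ultimately show False
    using generic[unfolded tropically_generic_def v, rule_format, of r k "\<lambda>a. g (r a)"] by blast
qed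

section \<open>Sectors and cells for finite entries\<close>

lemma mem_sector_real:
  assumes "\<And>i j. V $ i $ j = ereal (v i j)"
  shows "z \<in> sector (column j V) i \<longleftrightarrow> (\<forall>l. z $ l - v l j \<le> z $ i - v i j)"
  by (simp add: sector_def column_def assms algebra_simps)

text \<open>The strict inequalities are finitely many open conditions, so the cell contains an open
  neighbourhood of \<open>p\<close>.\<close>

lemma cell_full_dimensional_if_unique_maximizers:
  assumes v: "\<And>i j. V $ i $ j = ereal (v i j)"
    and strict: "\<And>i j. i \<noteq> s j \<Longrightarrow> p $ i - v i j < p $ s j - v (s j) j"
  shows "aff_dim (\<Inter>j. sector (column j V) (s j) :: (real^'d) set) = int DIM(real^'d)"
proof -
  define U :: "(real^'d) set"
    where "U = (\<Inter>j. \<Inter>i\<in>- {s j}. {q. q $ i - v i j < q $ s j - v (s j) j})"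
  have "open U"
    unfolding U_def by (intro open_INT finite ballI open_Collect_less continuous_intros)
  moreover have "p \<in> U"
    using strict by (auto simp: U_def)
  ultimately have "aff_dim U = int DIM(real^'d)"
    by (intro aff_dim_open) auto
  moreover have "x $ i - v i j \<le> x $ s j - v (s j) j" if "x \<in> U" for x i j
    using that by (cases "i = s j") (auto simp: U_def intro!: less_imp_le)
  then have "U \<subseteq> (\<Inter>j. sector (column j V) (s j))"
    by (auto simp: mem_sector_real[of V v, OF v])
  ultimately show ?thesis
    by (metis aff_dim_subset aff_dim_le_DIM order_antisym)
qed

text \<open>Moving from \<open>z\<close> along \<open>w\<close> breaks every tie in favour of
  \<open>s j\<close> at once, while inequalities already strict survive for small \<open>e\<close>
  by continuity.\<close>

lemma perturb_to_unique_maximizers: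
  fixes v :: "'d::finite \<Rightarrow> 'n::finite \<Rightarrow> real" and z :: "real^'d" and w :: "'d \<Rightarrow> real"
  assumes maximizer: "\<And>i j. z $ i - v i j \<le> z $ s j - v (s j) j"
    and rank: "\<And>i j. i \<noteq> s j \<Longrightarrow> z $ i - v i j = z $ s j - v (s j) j \<Longrightarrow> w i < w (s j)"
  obtains p where "\<And>i j. i \<noteq> s j \<Longrightarrow> p $ i - v i j < p $ s j - v (s j) j"
proof -
  let ?p = "\<lambda>e::real. \<chi> i. z $ i + e * w i"
  have ev: "\<forall>\<^sub>F e in at_right 0. i \<noteq> s j \<longrightarrow> ?p e $ i - v i j < ?p e $ s j - v (s j) j" for i j
  proof (cases "z $ i - v i j = z $ s j - v (s j) j")
    case True
    show ?thesis
      using eventually_at_right_less[of 0]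
    proof eventually_elim
      case (elim e)
      then have "e * w i < e * w (s j)" if "i \<noteq> s j"
        using rank[OF that True] by (simp add: mult_strict_left_mono)
      then show ?case
        using True by auto
    qed
  next
    case False
    then have "z $ i + 0 * w i - v i j < z $ s j + 0 * w (s j) - v (s j) j"
      using maximizer[of i j] by simp
    moreover have "((\<lambda>e. (z $ s j + e * w (s j) - v (s j) j) - (z $ i + e * w i - v i j))
        \<longlongrightarrow> (z $ s j + 0 * w (s j) - v (s j) j) - (z $ i + 0 * w i - v i j)) (at_right 0)"
      by (intro tendsto_intros)
    ultimately have "\<forall>\<^sub>F e in at_right 0.
        0 < (z $ s j + e * w (s j) - v (s j) j) - (z $ i + e * w i - v i j)"
      by (intro order_tendstoD) auto
    then show ?thesis
      by eventually_elim simp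
  qed
  have "\<forall>\<^sub>F e in at_right 0. \<forall>i j. i \<noteq> s j \<longrightarrow> ?p e $ i - v i j < ?p e $ s j - v (s j) j"
    by (intro eventually_all_finite ev)
  then obtain e where "\<forall>i j. i \<noteq> s j \<longrightarrow> ?p e $ i - v i j < ?p e $ s j - v (s j) j"
    using eventually_happens'[OF trivial_limit_at_right_real] by blast
  then show ?thesis
    by (intro that[of "?p e"]) blast
qed

text \<open>The gap between the values at \<open>i\<close> and \<open>l\<close> at the midpoint is
  the average of the gaps at \<open>y\<close> and \<open>z\<close>. Both are nonnegative because
  \<open>i\<close> is a common maximizer, so the average vanishes only if both do. The converse is
  convexity.\<close>

lemma midpoint_in_sector:
  assumes v: "\<And>i j. V $ i $ j = ereal (v i j)"
    and "y \<in> sector (column j V) i" "z \<in> sector (column j V) i"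
  shows "midpoint y z \<in> sector (column j V) l \<longleftrightarrow>
    y \<in> sector (column j V) l \<and> z \<in> sector (column j V) l"
proof -
  note mem = mem_sector_real[of V v, OF v]
  have mid: "midpoint y z $ a = (y $ a + z $ a) / 2" for a
    by (simp add: midpoint_def)
  have max: "y $ a - v a j \<le> y $ i - v i j" "z $ a - v a j \<le> z $ i - v i j" for a
    using assms(2,3) by (auto simp: mem)
  show ?thesis
  proof
    assume "midpoint y z \<in> sector (column j V) l"
    then have "(y $ i + z $ i) / 2 - v i j \<le> (y $ l + z $ l) / 2 - v l j"
      by (simp only: mem mid)
    then have "y $ l - v l j = y $ i - v i j" "z $ l - v l j = z $ i - v i j"
      using max(1)[of l] max(2)[of l] by (auto simp: field_simps)
    then show "y \<in> sector (column j V) l \<and> z \<in> sector (column j V) l"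
      using max by (simp add: mem)
  next
    assume "y \<in> sector (column j V) l \<and> z \<in> sector (column j V) l"
    then have "y $ a - v a j \<le> y $ l - v l j" "z $ a - v a j \<le> z $ l - v l j" for a
      by (auto simp: mem)
    then have "(y $ a - v a j + (z $ a - v a j)) / 2 \<le> (y $ l - v l j + (z $ l - v l j)) / 2" for a
      by (intro divide_right_mono add_mono) auto
    then show "midpoint y z \<in> sector (column j V) l"
      by (simp add: mem mid field_simps)
  qed
qed

text \<open>The point \<open>z\<close> serves as a relative interior point of \<open>C\<close>: the
  sectors through it are exactly those containing all of \<open>C\<close>.\<close>

lemma cell_generic_point:
  fixes V :: "ereal^'n^'d"
  assumes v: "\<And>i j. V $ i $ j = ereal (v i j)"
    and cell: "C \<in> covector_decomposition V"
  obtains z where "z \<in> C" "\<And>i j. z \<in> sector (column j V) i \<Longrightarrow> C \<subseteq> sector (column j V) i"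
proof -
  let ?S = "\<lambda>j. sector (column j V)"
  define T where "T z = {(i, j). z \<in> ?S j i}" for z
  from cell have "C \<noteq> {}"
    and "\<exists>F. C = (\<Inter>j. F j) \<and> (\<forall>j. F j \<in> sector_complex (column j V))"
    by (simp_all add: covector_decomposition_def)
  then obtain F where F: "C = (\<Inter>j. F j)" "\<And>j. F j \<in> sector_complex (column j V)"
    by blast
  have "\<exists>I. I \<noteq> {} \<and> F j = (\<Inter>i\<in>I. ?S j i)" for j
    using F(2)[of j] by (auto simp: sector_complex_def)
  then obtain I where I: "\<And>j. I j \<noteq> {}" "\<And>j. F j = (\<Inter>i\<in>I j. ?S j i)"
    by metis
  have CI: "z \<in> C \<longleftrightarrow> (\<forall>j. \<forall>i\<in>I j. z \<in> ?S j i)" for z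
    using F(1) I(2) by auto
  have mid: "midpoint y z \<in> ?S j i \<longleftrightarrow> y \<in> ?S j i \<and> z \<in> ?S j i"
    if "y \<in> C" "z \<in> C" for y z i j
  proof -
    obtain l where "l \<in> I j"
      using I(1)[of j] by blast
    then have "y \<in> ?S j l" "z \<in> ?S j l"
      using that by (auto simp: CI)
    then show ?thesis
      by (rule midpoint_in_sector[of V v, OF v])
  qed
  obtain c where "c \<in> C"
    using \<open>C \<noteq> {}\<close> by blast
  then obtain z where z: "z \<in> C" and min: "\<And>y. y \<in> C \<Longrightarrow> card (T z) \<le> card (T y)"
    using ex_has_least_nat[of "\<lambda>y. y \<in> C" c "\<lambda>y. card (T y)"] by blast
  have "y \<in> ?S j i" if "z \<in> ?S j i" "y \<in> C" for y i j
  proof -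
    \<comment> \<open>The midpoint lies precisely in the sectors common to \<open>z\<close> and
      \<open>y\<close>, so minimality of \<open>T z\<close> forces \<open>T z\<close> into
      \<open>T y\<close>.\<close>
    have "midpoint z y \<in> C"
      using mid[OF z \<open>y \<in> C\<close>] z \<open>y \<in> C\<close> by (simp add: CI)
    then have "card (T z) \<le> card (T z \<inter> T y)"
      using min[of "midpoint z y"] mid[OF z \<open>y \<in> C\<close>]
      by (simp add: T_def Int_def case_prod_unfold)
    then have "T z \<inter> T y = T z"
      by (intro card_seteq) auto
    then show ?thesis
      using that(1) by (auto simp: T_def)
  qed
  then show ?thesis
    using z that by blast
qed

theorem theorem45:
  fixes V :: "ereal^'n^'d" and \<Psi> :: "('d \<times> 'n) set"
  assumes "tropical_matrix V"
    and "\<forall>j. \<exists>i. column j V $ i \<noteq> \<infinity>"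
    and "tropically_generic V"
  shows "pure_full_dimensional (thalf_decomposition V \<Psi>)"
  unfolding pure_full_dimensional_def
proof
  fix C assume C: "C \<in> maximal_cells (thalf_decomposition V \<Psi>)"
  define v where "v i j = real_of_ereal (V $ i $ j)" for i j
  have v: "V $ i $ j = ereal (v i j)" for i j
    using assms(1) generic_entry_finite[OF assms(3)]
    by (auto simp: v_def tropical_matrix_def ereal_real)
  note mem = mem_sector_real[of V v, OF v]
  have "C \<in> covector_decomposition V" and sub: "C \<subseteq> thalf V \<Psi>"
    using C by (auto simp: maximal_cells_def thalf_decomposition_def)
  then obtain z where z: "z \<in> C"
    and zC: "\<And>i j. z \<in> sector (column j V) i \<Longrightarrow> C \<subseteq> sector (column j V) i"
    using cell_generic_point[of V v, OF v] by blast
  have "\<exists>i. (i, j) \<in> \<Psi> \<and> z \<in> sector (column j V) i" for j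
    using z sub by (auto simp: thalf_def)
  then obtain s where s: "\<And>j. (s j, j) \<in> \<Psi>" "\<And>j. z \<in> sector (column j V) (s j)"
    by metis
  have le: "z $ i - v i j \<le> z $ s j - v (s j) j" for i j
    using s(2) by (auto simp: mem)
  define R where "R = {(i, s j) |i j. i \<noteq> s j \<and> z $ i - v i j = z $ s j - v (s j) j}"
  define D where "D = (\<Inter>j. sector (column j V) (s j))"
  obtain w :: "'d \<Rightarrow> nat" where w: "\<And>i l. (i, l) \<in> R \<Longrightarrow> w i < w l"
  proof (cases R rule: strict_rank_or_permuted_subset)
    case (cycle A f)
    have "\<exists>j. f i = s j \<and> i \<noteq> s j \<and> z $ i - v i j = z $ s j - v (s j) j" if "i \<in> A" for i
      using cycle(3)[OF that] by (auto simp: R_def)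
    then obtain g where g: "\<And>i. i \<in> A \<Longrightarrow>
        f i = s (g i) \<and> i \<noteq> s (g i) \<and> z $ i - v i (g i) = z $ s (g i) - v (s (g i)) (g i)"
      by metis
    \<comment> \<open>Since \<open>f i = s (g i)\<close>, equal values of \<open>g\<close> give
      equal values of the injective \<open>f\<close>.\<close>
    have "inj_on g A"
      using cycle(2) g by (metis bij_betw_def inj_on_def)
    then have False
      \<comment> \<open>The dual solution is \<open>z\<close> on the rows and the maximum of
        \<open>z $ i - v i j\<close> over \<open>i\<close> on column \<open>j\<close>.\<close>
      using generic_no_tight_cycle[OF assms(3) v, of "\<lambda>i. z $ i" "\<lambda>j. z $ s j - v (s j) j" A f g]
        cycle(1,2) g le by (smt (verit))
    then show ?thesis ..
  qed blast
  have "real (w i) < real (w (s j))"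
    if "i \<noteq> s j" "z $ i - v i j = z $ s j - v (s j) j" for i j
    using w[of i "s j"] that unfolding R_def by (simp only: of_nat_less_iff) blast
  then obtain p where p: "\<And>i j. i \<noteq> s j \<Longrightarrow> p $ i - v i j < p $ s j - v (s j) j"
    using perturb_to_unique_maximizers[of z v s "\<lambda>i. real (w i)"] le by blast
  have dim: "aff_dim D = int DIM(real^'d)"
    unfolding D_def by (rule cell_full_dimensional_if_unique_maximizers[of V v, OF v p])
  have "C \<subseteq> D"
    using zC s(2) by (auto simp: D_def)
  have "sector (column j V) (s j) \<in> sector_complex (column j V)" for j
    unfolding sector_complex_def
    by (rule CollectI, rule exI[of _ "{s j}"]) (simp add: column_def v)
  \<comment> \<open>The point \<open>z\<close> shows that \<open>D\<close> is nonempty, as cells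
    must be.\<close>
  then have "D \<in> covector_decomposition V"
    using z \<open>C \<subseteq> D\<close> unfolding covector_decomposition_def D_def by blast
  moreover have "D \<subseteq> thalf V \<Psi>"
    using s(1) by (auto simp: D_def thalf_def)
  ultimately have "D = C"
    using C \<open>C \<subseteq> D\<close> by (auto simp: maximal_cells_def thalf_decomposition_def)
  then show "aff_dim C = int DIM(real^'d)"
    using dim by simp
qed

end
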